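(* Let $X\sim f_\theta$, $\theta\in\Theta$, be a given model, and consider estimating simultaneously $(\gamma,L)$, with $\gamma=\gamma(\theta)$ and $L=L(\theta,\hat\gamma)\geq 0$ a first-stage loss, under the loss $$W(\theta,\hat\gamma,\hat L)=h'(\hat L)\,L(\theta,\hat\gamma)-h'(\hat L)\,\hat L+h(\hat L),$$ where $h$ is an increasing, concave (differentiable) function on $(0,\infty)$. Suppose that there exist an estimator $(\hat\gamma_0,\hat L_0)$ and a sequence of proper prior densities $\{\pi_n;n\ge1\}$ such that: (i) $\hat\gamma_0(X)$ is, for first-stage loss $L$, an extended Bayes estimator of $\gamma$ (relative to $\{\pi_n\}$) with constant risk in $\theta$; (ii) for every $n\ge1$, the Bayes estimator $\hat L_{\pi_n}(x)$ is constant as a function of $x$; (iii) $\hat L_0(x)$ is the limit of $\hat L_{\pi_n}(x)$ as $n\to\infty$. Then $(\hat\gamma_0,\hat L_0)$ is minimax for estimating $(\gamma,L)$ under loss $W$.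
   Context: Estimators are pairs $(\hat\gamma(X),\hat L(X))$ with $\hat L(X)\in(0,\infty)$. The frequentist risk of $(\hat\gamma,\hat L)$ under $W$ is $R_W(\theta,(\hat\gamma,\hat L))=\mathbb{E}_\theta\big(W(\theta,\hat\gamma(X),\hat L(X))\big)$; a pair $(\hat\gamma_m,\hat L_m)$ is minimax if $\sup_\theta R_W(\theta,(\hat\gamma_m,\hat L_m))\le\sup_\theta R_W(\theta,(\hat\gamma,\hat L))$ for all $(\hat\gamma,\hat L)$. The first-stage risk of $\hat\gamma$ is $R(\theta,\hat\gamma)=\mathbb{E}_\theta(L(\theta,\hat\gamma(X)))$. For a prior $\pi$, the Bayes estimator of $(\gamma,L)$ under $W$ is $(\hat\gamma_\pi,\hat L_\pi)$, where $\hat\gamma_\pi(x)$ is the Bayes estimator of $\gamma(\theta)$ under first-stage loss $L$ (it minimizes $\mathbb{E}(L(\theta,\hat\gamma)|x)$ over $\hat\gamma$) and $\hat L_\pi(x)=\mathbb{E}\big(L(\theta,\hat\gamma_\pi(x))|x\big)$; these are assumed to exist for each $\pi_n$. With $r_n$ the integrated Bayes risk for first-stage loss under $\pi_n$ (i.e. $r_n=\int R(\theta,\hat\gamma_{\pi_n})\pi_n(\theta)\,d\theta$), the estimator $\hat\gamma_0$ is extended Bayes relative to $\{\pi_n\}$ if $\int R(\theta,\hat\gamma_0)\pi_n(\theta)\,d\theta-r_n\to0$ as $n\to\infty$; for $\hat\gamma_0$ with constant finite risk $\bar R$ this means $r_n\to\bar R$.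
   Formalization: Minimaxity holds among pairs whose risk under W is well defined at every θ and whose expectation of W under the joint law of (θ,X) exists (not ∞−∞) for each prior π_n; without this the claim fails, e.g. for h = log. It excludes nothing if h is bounded below. *)

theory Defs
  imports "HOL-Analysis.Analysis"
begin

text \<open>
  The parameter space is \<open>space T\<close>, the sample space \<open>space N\<close> and the set of possible values of
  an estimate of \<open>\<gamma>(\<theta>)\<close> is \<open>space A\<close>.  Densities on the sample space are taken with respect to
  \<open>N\<close>, prior densities with respect to \<open>T\<close>.  The estimand \<open>\<gamma>\<close> itself does not appear: it enters
  only through the first-stage loss \<open>L \<theta> d\<close>, which is an arbitrary nonnegative function of the
  parameter and the estimate.
\<close>

locale dominated_model = T: sigma_finite_measure T + N: sigma_finite_measure N
  for T :: "'p measure" and N :: "'x measure" +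
  fixes f :: "'p \<Rightarrow> 'x \<Rightarrow> ennreal"
  assumes f_measurable: "(\<lambda>(\<theta>, x). f \<theta> x) \<in> borel_measurable (T \<Otimes>\<^sub>M N)"
    and f_integral: "\<And>\<theta>. \<theta> \<in> space T \<Longrightarrow> (\<integral>\<^sup>+x. f \<theta> x \<partial>N) = 1"

definition first_stage_loss :: "'p measure \<Rightarrow> 'a measure \<Rightarrow> ('p \<Rightarrow> 'a \<Rightarrow> real) \<Rightarrow> bool" where
  "first_stage_loss T A L \<longleftrightarrow>
     (\<lambda>(\<theta>, d). L \<theta> d) \<in> borel_measurable (T \<Otimes>\<^sub>M A) \<and>
     (\<forall>\<theta>\<in>space T. \<forall>d\<in>space A. 0 \<le> L \<theta> d)"

definition proper_prior :: "'p measure \<Rightarrow> ('p \<Rightarrow> ennreal) \<Rightarrow> bool" where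
  "proper_prior T \<pi> \<longleftrightarrow> \<pi> \<in> borel_measurable T \<and> (\<integral>\<^sup>+\<theta>. \<pi> \<theta> \<partial>T) = 1"

definition estimators :: "'x measure \<Rightarrow> 'a measure \<Rightarrow> (('x \<Rightarrow> 'a) \<times> ('x \<Rightarrow> real)) set" where
  "estimators N A =
     {(g, l). g \<in> measurable N A \<and> l \<in> borel_measurable N \<and> (\<forall>x\<in>space N. 0 < l x)}"


subsection \<open>First stage: risk and Bayes estimators\<close>

definition risk ::
    "'x measure \<Rightarrow> ('p \<Rightarrow> 'x \<Rightarrow> ennreal) \<Rightarrow> ('p \<Rightarrow> 'a \<Rightarrow> real) \<Rightarrow> 'p \<Rightarrow> ('x \<Rightarrow> 'a) \<Rightarrow> ennreal" where
  "risk N f L \<theta> g = (\<integral>\<^sup>+x. ennreal (L \<theta> (g x)) \<partial>density N (f \<theta>))"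

definition integrated_risk ::
    "'p measure \<Rightarrow> 'x measure \<Rightarrow> ('p \<Rightarrow> 'x \<Rightarrow> ennreal) \<Rightarrow> ('p \<Rightarrow> 'a \<Rightarrow> real) \<Rightarrow>
     ('p \<Rightarrow> ennreal) \<Rightarrow> ('x \<Rightarrow> 'a) \<Rightarrow> ennreal" where
  "integrated_risk T N f L \<pi> g = (\<integral>\<^sup>+\<theta>. risk N f L \<theta> g * \<pi> \<theta> \<partial>T)"

definition marginal_density ::
    "'p measure \<Rightarrow> ('p \<Rightarrow> 'x \<Rightarrow> ennreal) \<Rightarrow> ('p \<Rightarrow> ennreal) \<Rightarrow> 'x \<Rightarrow> ennreal" where
  "marginal_density T f \<pi> x = (\<integral>\<^sup>+\<theta>. f \<theta> x * \<pi> \<theta> \<partial>T)"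

definition posterior ::
    "'p measure \<Rightarrow> ('p \<Rightarrow> 'x \<Rightarrow> ennreal) \<Rightarrow> ('p \<Rightarrow> ennreal) \<Rightarrow> 'x \<Rightarrow> 'p measure" where
  "posterior T f \<pi> x = density T (\<lambda>\<theta>. f \<theta> x * \<pi> \<theta> / marginal_density T f \<pi> x)"

definition posterior_loss ::
    "'p measure \<Rightarrow> ('p \<Rightarrow> 'x \<Rightarrow> ennreal) \<Rightarrow> ('p \<Rightarrow> 'a \<Rightarrow> real) \<Rightarrow> ('p \<Rightarrow> ennreal) \<Rightarrow>
     'x \<Rightarrow> 'a \<Rightarrow> ennreal" where
  "posterior_loss T f L \<pi> x d = (\<integral>\<^sup>+\<theta>. ennreal (L \<theta> d) \<partial>posterior T f \<pi> x)"

text \<open>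
  The posterior is determined only where the marginal density is positive and finite, so the two
  defining properties are required almost everywhere for the marginal distribution of the
  observation.
\<close>

definition bayes_estimator ::
    "'p measure \<Rightarrow> 'x measure \<Rightarrow> 'a measure \<Rightarrow> ('p \<Rightarrow> 'x \<Rightarrow> ennreal) \<Rightarrow> ('p \<Rightarrow> 'a \<Rightarrow> real) \<Rightarrow>
     ('p \<Rightarrow> ennreal) \<Rightarrow> ('x \<Rightarrow> 'a) \<times> ('x \<Rightarrow> real) \<Rightarrow> bool" where
  "bayes_estimator T N A f L \<pi> = (\<lambda>(g, l).
     (g, l) \<in> estimators N A \<and>
     (AE x in density N (marginal_density T f \<pi>).
        (\<forall>d\<in>space A. posterior_loss T f L \<pi> x (g x) \<le> posterior_loss T f L \<pi> x d) \<and>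
        ennreal (l x) = posterior_loss T f L \<pi> x (g x)))"

text \<open>
  In the extended reals \<open>\<infinity> - \<infinity> = \<infinity>\<close>, so the convergence to \<open>0\<close> forces both integrated risks to be
  finite from some \<open>n\<close> on.
\<close>

definition extended_bayes ::
    "'p measure \<Rightarrow> 'x measure \<Rightarrow> ('p \<Rightarrow> 'x \<Rightarrow> ennreal) \<Rightarrow> ('p \<Rightarrow> 'a \<Rightarrow> real) \<Rightarrow>
     (nat \<Rightarrow> 'p \<Rightarrow> ennreal) \<Rightarrow> (nat \<Rightarrow> 'x \<Rightarrow> 'a) \<Rightarrow> ('x \<Rightarrow> 'a) \<Rightarrow> bool" where
  "extended_bayes T N f L \<pi> g\<^sub>B g \<longleftrightarrow>
     (\<lambda>n. enn2ereal (integrated_risk T N f L (\<pi> n) g) -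
          enn2ereal (integrated_risk T N f L (\<pi> n) (g\<^sub>B n))) \<longlonglongrightarrow> 0"

definition constant_finite_risk ::
    "'p measure \<Rightarrow> 'x measure \<Rightarrow> ('p \<Rightarrow> 'x \<Rightarrow> ennreal) \<Rightarrow> ('p \<Rightarrow> 'a \<Rightarrow> real) \<Rightarrow> ('x \<Rightarrow> 'a) \<Rightarrow> bool"
  where
  "constant_finite_risk T N f L g \<longleftrightarrow>
     (\<exists>R. R < \<infinity> \<and> (\<forall>\<theta>\<in>space T. risk N f L \<theta> g = R))"


subsection \<open>Second stage: the loss W and minimaxity\<close>

definition W_loss :: "(real \<Rightarrow> real) \<Rightarrow> ('p \<Rightarrow> 'a \<Rightarrow> real) \<Rightarrow> 'p \<Rightarrow> 'a \<Rightarrow> real \<Rightarrow> real" where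
  "W_loss h L \<theta> d l = deriv h l * L \<theta> d - deriv h l * l + h l"

text \<open>
  \<open>W_loss\<close> may take negative values and be unbounded below (for instance for \<open>h = ln\<close>), hence
  expectations are extended-real valued, and defined unless the positive and the negative part
  both have infinite integral.
\<close>

definition quasi_integrable :: "'b measure \<Rightarrow> ('b \<Rightarrow> real) \<Rightarrow> bool" where
  "quasi_integrable M u \<longleftrightarrow>
     (\<integral>\<^sup>+x. ennreal (u x) \<partial>M) < \<infinity> \<or> (\<integral>\<^sup>+x. ennreal (- u x) \<partial>M) < \<infinity>"

definition expectation_ereal :: "'b measure \<Rightarrow> ('b \<Rightarrow> real) \<Rightarrow> ereal" where
  "expectation_ereal M u =
     enn2ereal (\<integral>\<^sup>+x. ennreal (u x) \<partial>M) - enn2ereal (\<integral>\<^sup>+x. ennreal (- u x) \<partial>M)"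

definition W_risk ::
    "'x measure \<Rightarrow> ('p \<Rightarrow> 'x \<Rightarrow> ennreal) \<Rightarrow> (real \<Rightarrow> real) \<Rightarrow> ('p \<Rightarrow> 'a \<Rightarrow> real) \<Rightarrow>
     'p \<Rightarrow> ('x \<Rightarrow> 'a) \<times> ('x \<Rightarrow> real) \<Rightarrow> ereal" where
  "W_risk N f h L \<theta> = (\<lambda>(g, l).
     expectation_ereal (density N (f \<theta>)) (\<lambda>x. W_loss h L \<theta> (g x) (l x)))"

definition W_risk_exists ::
    "'p measure \<Rightarrow> 'x measure \<Rightarrow> ('p \<Rightarrow> 'x \<Rightarrow> ennreal) \<Rightarrow> (real \<Rightarrow> real) \<Rightarrow> ('p \<Rightarrow> 'a \<Rightarrow> real) \<Rightarrow>
     ('x \<Rightarrow> 'a) \<times> ('x \<Rightarrow> real) \<Rightarrow> bool" where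
  "W_risk_exists T N f h L = (\<lambda>(g, l).
     \<forall>\<theta>\<in>space T. quasi_integrable (density N (f \<theta>)) (\<lambda>x. W_loss h L \<theta> (g x) (l x)))"

definition integrated_W_risk_exists ::
    "'p measure \<Rightarrow> 'x measure \<Rightarrow> ('p \<Rightarrow> 'x \<Rightarrow> ennreal) \<Rightarrow> (real \<Rightarrow> real) \<Rightarrow> ('p \<Rightarrow> 'a \<Rightarrow> real) \<Rightarrow>
     ('p \<Rightarrow> ennreal) \<Rightarrow> ('x \<Rightarrow> 'a) \<times> ('x \<Rightarrow> real) \<Rightarrow> bool" where
  "integrated_W_risk_exists T N f h L \<pi> = (\<lambda>(g, l).
     quasi_integrable (density (T \<Otimes>\<^sub>M N) (\<lambda>(\<theta>, x). f \<theta> x * \<pi> \<theta>))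
       (\<lambda>(\<theta>, x). W_loss h L \<theta> (g x) (l x)))"

text \<open>
  The pairs whose risk under W is well defined, at every parameter value and on average over each
  of the priors \<open>\<pi> n\<close>.  The second requirement cannot be dropped: if only the risks at fixed
  parameter values are required to exist, then for \<open>h = ln\<close> an expectation of W taken
  first over \<open>x\<close> and then over \<open>\<theta>\<close> may differ from the one taken in the other order, and a pair
  with uniformly smaller risk than the Bayes limit may exist.  Both requirements
  hold for every estimator when \<open>h\<close> is bounded below, as shown at the end of this theory.
\<close>

definition admitted_estimators ::
    "'p measure \<Rightarrow> 'x measure \<Rightarrow> 'a measure \<Rightarrow> ('p \<Rightarrow> 'x \<Rightarrow> ennreal) \<Rightarrow> (real \<Rightarrow> real) \<Rightarrow>
     ('p \<Rightarrow> 'a \<Rightarrow> real) \<Rightarrow> (nat \<Rightarrow> 'p \<Rightarrow> ennreal) \<Rightarrow> (('x \<Rightarrow> 'a) \<times> ('x \<Rightarrow> real)) set" where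
  "admitted_estimators T N A f h L \<pi> =
     {e \<in> estimators N A. W_risk_exists T N f h L e \<and>
        (\<forall>n\<ge>1. integrated_W_risk_exists T N f h L (\<pi> n) e)}"

definition minimax_among ::
    "'p measure \<Rightarrow> 'x measure \<Rightarrow> ('p \<Rightarrow> 'x \<Rightarrow> ennreal) \<Rightarrow> (real \<Rightarrow> real) \<Rightarrow> ('p \<Rightarrow> 'a \<Rightarrow> real) \<Rightarrow>
     (('x \<Rightarrow> 'a) \<times> ('x \<Rightarrow> real)) set \<Rightarrow> ('x \<Rightarrow> 'a) \<times> ('x \<Rightarrow> real) \<Rightarrow> bool" where
  "minimax_among T N f h L E e \<longleftrightarrow> e \<in> E \<and>
     (\<forall>e'\<in>E. (SUP \<theta>\<in>space T. W_risk N f h L \<theta> e) \<le> (SUP \<theta>\<in>space T. W_risk N f h L \<theta> e'))"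


subsection \<open>All estimators are admitted when h is bounded below\<close>

lemma W_loss_bounded_below:
  fixes h :: "real \<Rightarrow> real"
  assumes mono: "mono_on {0<..} h" and conc: "concave_on {0<..} h"
    and diff: "h differentiable_on {0<..}"
    and bound: "\<And>t. 0 < t \<Longrightarrow> B \<le> h t"
    and l: "0 < l" and L: "0 \<le> L \<theta> d"
  shows "B \<le> W_loss h L \<theta> d l"
proof -
  have D: "(h has_real_derivative deriv h l) (at l)"
  proof -
    have "h differentiable (at l within {0<..})"
      using diff l by (auto simp: differentiable_on_def)
    then have "h differentiable (at l)"
      using l by (simp add: at_within_open[of l "{0<..}"])
    then show ?thesis
      using DERIV_deriv_iff_real_differentiable by blast
  qed
  have tangent: "h s \<le> h l + deriv h l * (s - l)" if "0 < s" for s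
  proof -
    have "- deriv h l * (s - l) \<le> (- h s) - (- h l)"
    proof (rule convex_on_imp_above_tangent[where A = "{0<..}"])
      show "convex_on {0<..} (\<lambda>x. - h x)"
        using conc by (simp add: concave_on_def)
      show "((\<lambda>x. - h x) has_field_derivative - deriv h l) (at l within {0<..})"
        using has_field_derivative_at_within[OF DERIV_minus[OF D]] .
    qed (use l that in \<open>auto simp: interior_open\<close>)
    then show ?thesis by simp
  qed
  have "h l \<le> h (l + 1)"
    using mono l by (auto simp: mono_on_def)
  with tangent[of "l + 1"] l have pos: "0 \<le> deriv h l"
    by simp
  have "B \<le> h l - deriv h l * l"
  proof (rule field_le_epsilon)
    fix e :: real assume e: "0 < e"
    define s where "s = e / (deriv h l + 1)"
    have s: "0 < s" using e pos by (simp add: s_def)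
    have "deriv h l * s \<le> e"
      using e pos by (simp add: s_def field_simps)
    with bound[OF s] tangent[OF s] show "B \<le> h l - deriv h l * l + e"
      by (simp add: algebra_simps)
  qed
  moreover have "0 \<le> deriv h l * L \<theta> d"
    using pos L by simp
  ultimately show ?thesis by (simp add: W_loss_def)
qed

lemma quasi_integrable_bounded_below:
  assumes "emeasure M (space M) < \<infinity>" and "\<And>x. x \<in> space M \<Longrightarrow> B \<le> u x"
  shows "quasi_integrable M u"
proof -
  have "(\<integral>\<^sup>+x. ennreal (- u x) \<partial>M) \<le> (\<integral>\<^sup>+x. ennreal \<bar>B\<bar> \<partial>M)"
  proof (rule nn_integral_mono)
    fix x assume "x \<in> space M"
    with assms(2) have "B \<le> u x" by simp
    then show "ennreal (- u x) \<le> ennreal \<bar>B\<bar>" by (intro ennreal_leI) linarith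
  qed
  also have "\<dots> < \<infinity>"
    using assms(1) by (simp add: ennreal_mult_less_top)
  finally show ?thesis by (simp add: quasi_integrable_def)
qed

lemma (in dominated_model) admitted_estimators_bounded_below:
  assumes L: "first_stage_loss T A L"
    and h: "mono_on {0<..} h" "concave_on {0<..} h" "h differentiable_on {0<..}"
    and bound: "\<And>t. 0 < t \<Longrightarrow> B \<le> h t"
    and prior: "\<And>n. 1 \<le> n \<Longrightarrow> proper_prior T (\<pi> n)"
  shows "admitted_estimators T N A f h L \<pi> = estimators N A"
proof -
  have fm[measurable]: "case_prod f \<in> borel_measurable (T \<Otimes>\<^sub>M N)"
    using f_measurable by simp
  have "W_risk_exists T N f h L e \<and> (\<forall>n\<ge>1. integrated_W_risk_exists T N f h L (\<pi> n) e)"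
    if "e \<in> estimators N A" for e
  proof -
    obtain g l where e: "e = (g, l)" by force
    have W: "B \<le> W_loss h L \<theta> (g x) (l x)" if "\<theta> \<in> space T" "x \<in> space N" for \<theta> x
    proof (rule W_loss_bounded_below[OF h bound])
      show "0 < l x" "0 \<le> L \<theta> (g x)"
        using \<open>e \<in> estimators N A\<close> L that
        by (auto simp: e estimators_def first_stage_loss_def dest: measurable_space)
    qed
    have "quasi_integrable (density N (f \<theta>)) (\<lambda>x. W_loss h L \<theta> (g x) (l x))"
      if \<theta>: "\<theta> \<in> space T" for \<theta>
    proof (rule quasi_integrable_bounded_below)
      have [measurable]: "f \<theta> \<in> borel_measurable N"
        using measurable_compose[OF measurable_Pair1'[OF \<theta>] fm] by simp
      have "emeasure (density N (f \<theta>)) (space N) = (\<integral>\<^sup>+x. f \<theta> x \<partial>N)"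
        by (simp add: emeasure_density cong: nn_integral_cong)
      then show "emeasure (density N (f \<theta>)) (space (density N (f \<theta>))) < \<infinity>"
        by (simp add: f_integral[OF \<theta>])
    qed (use W \<theta> in auto)
    moreover have "quasi_integrable (density (T \<Otimes>\<^sub>M N) (\<lambda>(\<theta>, x). f \<theta> x * \<pi> n \<theta>))
        (\<lambda>(\<theta>, x). W_loss h L \<theta> (g x) (l x))" if n: "1 \<le> n" for n
    proof (rule quasi_integrable_bounded_below)
      have [measurable]: "\<pi> n \<in> borel_measurable T"
        using prior[OF n] by (simp add: proper_prior_def)
      let ?D = "density (T \<Otimes>\<^sub>M N) (\<lambda>(\<theta>, x). f \<theta> x * \<pi> n \<theta>)"
      have "emeasure ?D (space ?D) =
          (\<integral>\<^sup>+z. (case z of (\<theta>, x) \<Rightarrow> f \<theta> x * \<pi> n \<theta>) \<partial>(T \<Otimes>\<^sub>M N))"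
        by (subst emeasure_density) (auto intro!: nn_integral_cong)
      also have "\<dots> = (\<integral>\<^sup>+\<theta>. \<integral>\<^sup>+x. f \<theta> x * \<pi> n \<theta> \<partial>N \<partial>T)"
        by (subst N.nn_integral_fst[symmetric]) auto
      also have "\<dots> = (\<integral>\<^sup>+\<theta>. \<pi> n \<theta> \<partial>T)"
      proof (rule nn_integral_cong)
        fix \<theta> assume \<theta>: "\<theta> \<in> space T"
        have [measurable]: "f \<theta> \<in> borel_measurable N"
          using measurable_compose[OF measurable_Pair1'[OF \<theta>] fm] by simp
        show "(\<integral>\<^sup>+x. f \<theta> x * \<pi> n \<theta> \<partial>N) = \<pi> n \<theta>"
          by (simp add: nn_integral_multc f_integral[OF \<theta>])
      qed
      also have "\<dots> = 1"
        using prior[OF n] by (simp add: proper_prior_def)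
      finally show "emeasure ?D (space ?D) < \<infinity>" by simp
    qed (use W in \<open>auto simp: space_pair_measure\<close>)
    ultimately show ?thesis
      by (simp add: e W_risk_exists_def integrated_W_risk_exists_def)
  qed
  then show ?thesis by (auto simp: admitted_estimators_def)
qed

end

theory Submission
  imports Defs "HOL-Probability.Probability_Measure"
begin

text \<open>
  Everything rests on two properties of W.  For a fixed estimate \<open>l\<close> of the loss it is affine in the
  first-stage loss, with slope \<open>deriv h l\<close>, nonnegative since \<open>h\<close> increases; and for a
  fixed value \<open>t\<close> of the first-stage loss it is the height at \<open>t\<close> of the tangent to \<open>h\<close> at \<open>l\<close>, hence at least \<open>h t\<close> when \<open>t\<close> is
  positive, with equality for \<open>l = t\<close>.

  Let \<open>c n\<close> be the constant value of the Bayes loss estimate under \<open>\<pi> n\<close>.  Being the posterior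
  expected loss of \<open>\<gamma>\<^sub>B n\<close> at almost every observation, it is also the integrated Bayes risk
  (\<open>integrated_risk_bayes\<close>).  The extended Bayes property therefore makes \<open>c n\<close> converge to the
  constant risk of \<open>\<gamma>\<^sub>0\<close>, which must then be the constant value \<open>C\<close> of \<open>L\<^sub>0\<close>, and the W-risk of
  \<open>(\<gamma>\<^sub>0, L\<^sub>0)\<close> is at most \<open>h C\<close> (\<open>W_risk_constant_loss_estimate\<close>).

  Conversely, for any competitor and almost every observation, the posterior expected first-stage
  loss is at least \<open>c n\<close>, so the posterior expectation of W is at least \<open>h (c n)\<close>
  (\<open>joint_W_lower_bound\<close>).  A uniform bound \<open>b\<close> on the competitor's W-risk gives \<open>b\<close> as
  an upper bound for the expectation of W under the joint distribution
  (\<open>joint_W_upper_bound\<close>).  Hence \<open>h (c n) \<le> b\<close>, and continuity of \<open>h\<close> yields \<open>h C \<le> b\<close>.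

  Since W can be unbounded in both directions, the two bounds are proved as inequalities between
  integrals of positive and negative parts.  The interchange of the order of integration is then an
  instance of Tonelli's theorem; the existence of the joint expectation enters when the two bounds are
  compared with each other (\<open>bayes_W_bound_le_risk_bound\<close>).
\<close>

section \<open>Increasing concave functions on the positive half-line\<close>

lemma differentiable_on_pos_DERIV:
  fixes h :: "real \<Rightarrow> real"
  assumes "h differentiable_on {0<..}" "0 < t"
  shows "(h has_real_derivative deriv h t) (at t)"
proof -
  have "h differentiable (at t within {0<..})"
    using assms by (auto simp: differentiable_on_def)
  then have "h differentiable (at t)"
    using assms(2) by (simp add: at_within_open[of t "{0<..}"])
  then show ?thesis
    using DERIV_deriv_iff_real_differentiable by blast
qed

lemma concave_below_tangent:
  fixes h :: "real \<Rightarrow> real"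
  assumes "concave_on {0<..} h" "h differentiable_on {0<..}" "0 < s" "0 < t"
  shows "h s \<le> h t + deriv h t * (s - t)"
proof -
  have "- deriv h t * (s - t) \<le> (- h s) - (- h t)"
  proof (rule convex_on_imp_above_tangent[where A = "{0<..}"])
    show "convex_on {0<..} (\<lambda>x. - h x)"
      using assms(1) by (simp add: concave_on_def)
    show "((\<lambda>x. - h x) has_field_derivative - deriv h t) (at t within {0<..})"
      using has_field_derivative_at_within[OF DERIV_minus[OF differentiable_on_pos_DERIV[OF assms(2,4)]]] .
  qed (use assms(3,4) in \<open>auto simp: interior_open\<close>)
  then show ?thesis by simp
qed

lemma concave_deriv_nonneg:
  fixes h :: "real \<Rightarrow> real"
  assumes "mono_on {0<..} h" "concave_on {0<..} h" "h differentiable_on {0<..}" "0 < t"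
  shows "0 \<le> deriv h t"
proof -
  have "h t \<le> h (t + 1)"
    using assms(1,4) by (auto simp: mono_on_def)
  with concave_below_tangent[OF assms(2,3), of "t + 1" t] assms(4) show ?thesis by simp
qed

lemma concave_deriv_antimono:
  fixes h :: "real \<Rightarrow> real"
  assumes "concave_on {0<..} h" "h differentiable_on {0<..}" "0 < s" "s \<le> t"
  shows "deriv h t \<le> deriv h s"
proof (cases "s = t")
  case False
  \<comment> \<open>Add the two inequalities that compare the graph at each point with the tangent at the other.\<close>
  have "0 \<le> (deriv h s - deriv h t) * (t - s)"
    using concave_below_tangent[OF assms(1,2), of s t] concave_below_tangent[OF assms(1,2), of t s]
      assms(3,4) by (simp add: algebra_simps)
  with False assms(4) show ?thesis by (simp add: zero_le_mult_iff)
qed simp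

text \<open>Both functions are monotone on the half-line that contains the values of \<open>l\<close>.\<close>

lemma measurable_concave_compose:
  fixes h :: "real \<Rightarrow> real"
  assumes "mono_on {0<..} h" "concave_on {0<..} h" "h differentiable_on {0<..}"
    and l: "l \<in> borel_measurable N" "\<And>x. x \<in> space N \<Longrightarrow> 0 < l x"
  shows "(\<lambda>x. h (l x)) \<in> borel_measurable N" "(\<lambda>x. deriv h (l x)) \<in> borel_measurable N"
proof -
  have l': "l \<in> measurable N (restrict_space borel {0<..})"
    using l by (auto intro!: measurable_restrict_space2)
  show "(\<lambda>x. h (l x)) \<in> borel_measurable N"
    using measurable_compose[OF l' borel_measurable_mono_on_fnc[OF assms(1)]] .
  have "mono_on {0<..} (\<lambda>t. - deriv h t)"
    using concave_deriv_antimono[OF assms(2,3)] by (auto simp: mono_on_def)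
  from measurable_compose[OF l' borel_measurable_mono_on_fnc[OF this]]
  show "(\<lambda>x. deriv h (l x)) \<in> borel_measurable N" by simp
qed

section \<open>Extended expectations of affine functions of a nonnegative variable\<close>

text \<open>
  An extended expectation is a difference of integrals of positive and negative parts.  Statements
  about it become additive inequalities between nonnegative integrals once the negative terms
  are moved to the other side, and such inequalities can be integrated without finiteness
  assumptions.  The clause on the positive part accounts for \<open>\<infinity> - \<infinity> = \<infinity>\<close>.
\<close>

lemma expectation_ereal_le_iff:
  "expectation_ereal M u \<le> ereal b \<longleftrightarrow>
     (\<integral>\<^sup>+x. ennreal (u x) \<partial>M) < \<infinity> \<and>
     (\<integral>\<^sup>+x. ennreal (u x) \<partial>M) + ennreal (- b) \<le> (\<integral>\<^sup>+x. ennreal (- u x) \<partial>M) + ennreal b"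
proof -
  have "enn2ereal p - enn2ereal q \<le> ereal b \<longleftrightarrow> p < \<infinity> \<and> p + ennreal (- b) \<le> q + ennreal b" for p q
  proof (cases p; cases q)
    fix r s :: real
    assume *: "0 \<le> r" "p = ennreal r" "0 \<le> s" "q = ennreal s"
    then show ?thesis
      by (cases "0 \<le> b") (auto simp: enn2ereal_ennreal ennreal_neg simp flip: ennreal_plus)
  qed (auto simp: enn2ereal_ennreal)
  then show ?thesis by (simp add: expectation_ereal_def)
qed

text \<open>
  The first equation is the additive form of linearity of the expectation.  By the second claim the
  negative part is integrable, which is what makes the expectation exist.
\<close>

lemma nn_integral_affine_parts:
  fixes v :: "'b \<Rightarrow> real"
  assumes "prob_space M" and v[measurable]: "v \<in> borel_measurable M"
    and "\<And>x. x \<in> space M \<Longrightarrow> 0 \<le> v x" "0 \<le> a"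
  shows "(\<integral>\<^sup>+x. ennreal (a * v x + K) \<partial>M) + ennreal (- K) =
      ennreal a * (\<integral>\<^sup>+x. ennreal (v x) \<partial>M) + ennreal K + (\<integral>\<^sup>+x. ennreal (- (a * v x + K)) \<partial>M)"
    and "(\<integral>\<^sup>+x. ennreal (- (a * v x + K)) \<partial>M) \<le> ennreal (- K)"
proof -
  interpret prob_space M by fact
  have "(\<integral>\<^sup>+x. ennreal (a * v x + K) \<partial>M) + ennreal (- K) =
      (\<integral>\<^sup>+x. ennreal (a * v x + K) + ennreal (- K) \<partial>M)"
    by (subst nn_integral_add) (auto simp: emeasure_space_1)
  also have "\<dots> = (\<integral>\<^sup>+x. ennreal a * ennreal (v x) + ennreal K + ennreal (- (a * v x + K)) \<partial>M)"
  proof (rule nn_integral_cong)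
    fix x assume "x \<in> space M"
    then have nn: "0 \<le> a * v x" using assms(3,4) by simp
    have "ennreal (a * v x + K) + ennreal (- K) = ennreal (a * v x) + ennreal K + ennreal (- (a * v x + K))"
      using nn
      by (cases "0 \<le> K"; cases "0 \<le> a * v x + K")
         (simp_all add: ennreal_neg flip: ennreal_plus)
    then show "ennreal (a * v x + K) + ennreal (- K) =
        ennreal a * ennreal (v x) + ennreal K + ennreal (- (a * v x + K))"
      using assms(4) by (simp add: ennreal_mult')
  qed
  also have "\<dots> = ennreal a * (\<integral>\<^sup>+x. ennreal (v x) \<partial>M) + ennreal K
      + (\<integral>\<^sup>+x. ennreal (- (a * v x + K)) \<partial>M)"
    by (simp add: nn_integral_add nn_integral_cmult emeasure_space_1)
  finally show "(\<integral>\<^sup>+x. ennreal (a * v x + K) \<partial>M) + ennreal (- K) =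
      ennreal a * (\<integral>\<^sup>+x. ennreal (v x) \<partial>M) + ennreal K
      + (\<integral>\<^sup>+x. ennreal (- (a * v x + K)) \<partial>M)" .
  have "(\<integral>\<^sup>+x. ennreal (- (a * v x + K)) \<partial>M) \<le> (\<integral>\<^sup>+x. ennreal (- K) \<partial>M)"
    using assms(3,4) by (intro nn_integral_mono ennreal_leI) auto
  then show "(\<integral>\<^sup>+x. ennreal (- (a * v x + K)) \<partial>M) \<le> ennreal (- K)"
    by (simp add: emeasure_space_1)
qed

lemma ennreal_parts_le:
  assumes "b \<le> d + k" "0 \<le> d"
  shows "ennreal b + ennreal (- k) \<le> ennreal d + ennreal k + ennreal (- b)"
proof (cases "0 \<le> b"; cases "0 \<le> k")
qed (use assms in \<open>auto simp: ennreal_neg intro!: ennreal_leI simp flip: ennreal_plus\<close>)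

text \<open>
  In additive form, this says that the mean of \<open>a * v + K\<close> is at least \<open>b\<close>.  The mean of \<open>v\<close> may be
  infinite, but \<open>ennreal (- K)\<close> is finite and can be cancelled from both sides of the balance
  between the parts.
\<close>

lemma nn_integral_affine_ge:
  fixes v :: "'b \<Rightarrow> real"
  assumes "prob_space M" "v \<in> borel_measurable M" "\<And>x. x \<in> space M \<Longrightarrow> 0 \<le> v x" "0 \<le> a"
    and c: "ennreal c \<le> (\<integral>\<^sup>+x. ennreal (v x) \<partial>M)" "0 \<le> c" and b: "b \<le> a * c + K"
  shows "(\<integral>\<^sup>+x. ennreal (- (a * v x + K)) \<partial>M) + ennreal b \<le>
      (\<integral>\<^sup>+x. ennreal (a * v x + K) \<partial>M) + ennreal (- b)"
    (is "?Q + _ \<le> ?P + _")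
proof -
  have "ennreal (- K) + (?Q + ennreal b) = ?Q + (ennreal b + ennreal (- K))"
    by (simp add: ac_simps)
  also have "\<dots> \<le> ?Q + (ennreal (a * c) + ennreal K + ennreal (- b))"
    using assms(4) c(2) b by (intro add_left_mono ennreal_parts_le) auto
  also have "\<dots> \<le> ?Q + (ennreal a * (\<integral>\<^sup>+x. ennreal (v x) \<partial>M) + ennreal K + ennreal (- b))"
    using c assms(4) by (intro add_mono) (auto simp: ennreal_mult intro!: mult_left_mono)
  also have "\<dots> = ennreal (- K) + (?P + ennreal (- b))"
    using nn_integral_affine_parts(1)[where v = v and M = M, OF assms(1-4), of K] by (simp add: ac_simps)
  finally show ?thesis
    using ennreal_add_left_cancel_le[of "ennreal (- K)"] by auto
qed

lemma expectation_ereal_affine_le: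
  fixes v :: "'b \<Rightarrow> real"
  assumes "prob_space M" "v \<in> borel_measurable M" "\<And>x. x \<in> space M \<Longrightarrow> 0 \<le> v x" "0 \<le> a"
    and c: "(\<integral>\<^sup>+x. ennreal (v x) \<partial>M) = ennreal c" "0 \<le> c"
  shows "expectation_ereal M (\<lambda>x. a * v x + K) \<le> ereal (a * c + K)"
proof -
  let ?P = "\<integral>\<^sup>+x. ennreal (a * v x + K) \<partial>M" and ?Q = "\<integral>\<^sup>+x. ennreal (- (a * v x + K)) \<partial>M"
  have eq: "?P + ennreal (- K) = ennreal (a * c) + ennreal K + ?Q"
    using nn_integral_affine_parts(1)[where v = v and M = M, OF assms(1-4), of K] c assms(4) by (simp add: ennreal_mult)
  have Q: "?Q \<le> ennreal (- K)"
    using nn_integral_affine_parts(2)[where v = v and M = M, OF assms(1-4)] .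
  obtain q where q: "?Q = ennreal q" "0 \<le> q"
    using Q by (cases ?Q) (auto simp: top_unique)
  have "?P + ennreal (- K) < \<infinity>"
    unfolding eq q by simp
  then obtain p where p: "?P = ennreal p" "0 \<le> p"
    by (cases ?P) auto
  have ac: "0 \<le> a * c" using assms(4) c by simp
  have "p + max 0 (- K) = a * c + max 0 K + q"
  proof -
    have "ennreal (p + max 0 (- K)) = ennreal (a * c + max 0 K + q)"
      using eq p q ac by (simp add: ennreal_plus ennreal_max_0)
    then show ?thesis
      using p q ac by (subst (asm) ennreal_inj) auto
  qed
  then have "p - q \<le> a * c + K" by linarith
  then show ?thesis
    using p q by (simp add: expectation_ereal_def enn2ereal_ennreal)
qed

section \<open>The joint distribution of parameter and observation\<close>

locale bayesian_model = dominated_model T N f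
  for T :: "'p measure" and N :: "'x measure" and f :: "'p \<Rightarrow> 'x \<Rightarrow> ennreal" +
  fixes \<pi> :: "'p \<Rightarrow> ennreal"
  assumes prior: "proper_prior T \<pi>"
begin

sublocale TN: pair_sigma_finite T N ..

lemma f_pair_measurable [measurable]: "case_prod f \<in> borel_measurable (T \<Otimes>\<^sub>M N)"
  using f_measurable by simp

lemma prior_measurable [measurable]: "\<pi> \<in> borel_measurable T"
  using prior by (simp add: proper_prior_def)

lemma prior_integral: "(\<integral>\<^sup>+\<theta>. \<pi> \<theta> \<partial>T) = 1"
  using prior by (simp add: proper_prior_def)

lemma density_measurable: "\<theta> \<in> space T \<Longrightarrow> f \<theta> \<in> borel_measurable N"
  using measurable_compose[OF measurable_Pair1' f_pair_measurable] by simp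

lemma likelihood_measurable: "x \<in> space N \<Longrightarrow> (\<lambda>\<theta>. f \<theta> x) \<in> borel_measurable T"
  using measurable_compose[OF measurable_Pair2' f_pair_measurable] by simp

lemma prob_space_density:
  assumes "\<theta> \<in> space T"
  shows "prob_space (density N (f \<theta>))"
proof
  have "emeasure (density N (f \<theta>)) (space N) = (\<integral>\<^sup>+x. f \<theta> x \<partial>N)"
    using density_measurable[OF assms] by (simp add: emeasure_density cong: nn_integral_cong)
  then show "emeasure (density N (f \<theta>)) (space (density N (f \<theta>))) = 1"
    by (simp add: f_integral[OF assms])
qed

abbreviation joint :: "('p \<times> 'x) measure" where
  "joint \<equiv> density (T \<Otimes>\<^sub>M N) (\<lambda>(\<theta>, x). f \<theta> x * \<pi> \<theta>)"

lemma joint_integral_fst: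
  assumes [measurable]: "(\<lambda>(\<theta>, x). w \<theta> x) \<in> borel_measurable (T \<Otimes>\<^sub>M N)"
  shows "(\<integral>\<^sup>+(\<theta>, x). w \<theta> x \<partial>joint) = (\<integral>\<^sup>+\<theta>. (\<integral>\<^sup>+x. w \<theta> x \<partial>density N (f \<theta>)) * \<pi> \<theta> \<partial>T)"
proof -
  have "(\<integral>\<^sup>+(\<theta>, x). w \<theta> x \<partial>joint) = (\<integral>\<^sup>+(\<theta>, x). f \<theta> x * \<pi> \<theta> * w \<theta> x \<partial>(T \<Otimes>\<^sub>M N))"
    by (subst nn_integral_density) (auto intro!: nn_integral_cong)
  also have "\<dots> = (\<integral>\<^sup>+\<theta>. \<integral>\<^sup>+x. f \<theta> x * \<pi> \<theta> * w \<theta> x \<partial>N \<partial>T)"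
    by (subst N.nn_integral_fst[symmetric]) auto
  also have "\<dots> = (\<integral>\<^sup>+\<theta>. (\<integral>\<^sup>+x. w \<theta> x \<partial>density N (f \<theta>)) * \<pi> \<theta> \<partial>T)"
  proof (rule nn_integral_cong)
    fix \<theta> assume \<theta>: "\<theta> \<in> space T"
    have [measurable]: "f \<theta> \<in> borel_measurable N" "w \<theta> \<in> borel_measurable N"
      using density_measurable[OF \<theta>] measurable_compose[OF measurable_Pair1'[OF \<theta>] assms] by simp_all
    show "(\<integral>\<^sup>+x. f \<theta> x * \<pi> \<theta> * w \<theta> x \<partial>N) = (\<integral>\<^sup>+x. w \<theta> x \<partial>density N (f \<theta>)) * \<pi> \<theta>"
      by (simp add: nn_integral_density nn_integral_cmult ac_simps)
  qed
  finally show ?thesis .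
qed

lemma joint_integral_snd:
  assumes [measurable]: "(\<lambda>(\<theta>, x). w \<theta> x) \<in> borel_measurable (T \<Otimes>\<^sub>M N)"
  shows "(\<integral>\<^sup>+(\<theta>, x). w \<theta> x \<partial>joint) = (\<integral>\<^sup>+x. \<integral>\<^sup>+\<theta>. w \<theta> x * (f \<theta> x * \<pi> \<theta>) \<partial>T \<partial>N)"
proof -
  have "(\<integral>\<^sup>+(\<theta>, x). w \<theta> x \<partial>joint) = (\<integral>\<^sup>+(\<theta>, x). w \<theta> x * (f \<theta> x * \<pi> \<theta>) \<partial>(T \<Otimes>\<^sub>M N))"
    by (subst nn_integral_density) (auto intro!: nn_integral_cong simp: ac_simps)
  also have "\<dots> = (\<integral>\<^sup>+x. \<integral>\<^sup>+\<theta>. w \<theta> x * (f \<theta> x * \<pi> \<theta>) \<partial>T \<partial>N)"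
    by (subst TN.nn_integral_snd[symmetric]) auto
  finally show ?thesis .
qed

lemma joint_mass: "emeasure joint (space joint) = 1"
proof -
  have "emeasure joint (space joint) = (\<integral>\<^sup>+(\<theta>, x). 1 \<partial>joint)"
    by (simp add: case_prod_beta')
  also have "\<dots> = (\<integral>\<^sup>+\<theta>. (\<integral>\<^sup>+x. 1 \<partial>density N (f \<theta>)) * \<pi> \<theta> \<partial>T)"
    by (rule joint_integral_fst) simp
  also have "\<dots> = (\<integral>\<^sup>+\<theta>. \<pi> \<theta> \<partial>T)"
    by (intro nn_integral_cong) (use prob_space.emeasure_space_1[OF prob_space_density] in auto)
  finally show ?thesis by (simp add: prior_integral)
qed

abbreviation marginal :: "'x \<Rightarrow> ennreal" where
  "marginal \<equiv> marginal_density T f \<pi>"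

lemma marginal_measurable [measurable]: "marginal \<in> borel_measurable N"
  unfolding marginal_density_def by measurable

lemma marginal_integral: "(\<integral>\<^sup>+x. marginal x \<partial>N) = 1"
  using joint_integral_snd[of "\<lambda>_ _. 1"] joint_mass by (simp add: marginal_density_def case_prod_beta')

lemma marginal_finite: "AE x in N. marginal x < \<infinity>"
  using nn_integral_PInf_AE[of marginal N] marginal_integral by (auto simp: top.not_eq_extremum)

text \<open>
  Disintegration of the joint distribution.  Where the marginal density vanishes the posterior is
  meaningless, but there the integrand on the left vanishes almost everywhere too.
\<close>

lemma posterior_integral:
  assumes x: "x \<in> space N" and fin: "marginal x < \<infinity>" and u[measurable]: "u \<in> borel_measurable T"
  shows "(\<integral>\<^sup>+\<theta>. u \<theta> * (f \<theta> x * \<pi> \<theta>) \<partial>T) = marginal x * (\<integral>\<^sup>+\<theta>. u \<theta> \<partial>posterior T f \<pi> x)"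
proof (cases "marginal x = 0")
  case True
  note [measurable] = likelihood_measurable[OF x]
  have "AE \<theta> in T. f \<theta> x * \<pi> \<theta> = 0"
    using True by (subst (asm) marginal_density_def, subst (asm) nn_integral_0_iff_AE) auto
  then have "AE \<theta> in T. u \<theta> * (f \<theta> x * \<pi> \<theta>) = 0" by eventually_elim simp
  then have "(\<integral>\<^sup>+\<theta>. u \<theta> * (f \<theta> x * \<pi> \<theta>) \<partial>T) = 0"
    by (subst nn_integral_0_iff_AE) auto
  with True show ?thesis by simp
next
  case False
  note [measurable] = likelihood_measurable[OF x]
  have "marginal x * (\<integral>\<^sup>+\<theta>. u \<theta> \<partial>posterior T f \<pi> x) =
      (\<integral>\<^sup>+\<theta>. marginal x * (f \<theta> x * \<pi> \<theta> / marginal x * u \<theta>) \<partial>T)"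
    unfolding posterior_def by (simp add: nn_integral_density nn_integral_cmult)
  also have "\<dots> = (\<integral>\<^sup>+\<theta>. u \<theta> * (f \<theta> x * \<pi> \<theta>) \<partial>T)"
  proof (rule nn_integral_cong)
    fix \<theta>
    have "marginal x * (f \<theta> x * \<pi> \<theta> / marginal x) = f \<theta> x * \<pi> \<theta>"
      using False fin
      by (simp add: ennreal_times_divide ennreal_mult_divide_eq mult.commute[of "marginal x"])
    then show "marginal x * (f \<theta> x * \<pi> \<theta> / marginal x * u \<theta>) = u \<theta> * (f \<theta> x * \<pi> \<theta>)"
      by (metis mult.assoc mult.commute)
  qed
  finally show ?thesis by simp
qed

lemma prob_space_posterior:
  assumes "x \<in> space N" "marginal x < \<infinity>" "marginal x \<noteq> 0"
  shows "prob_space (posterior T f \<pi> x)"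
proof
  let ?e = "emeasure (posterior T f \<pi> x) (space (posterior T f \<pi> x))"
  have "marginal x * ?e = marginal x * 1"
    using posterior_integral[OF assms(1,2), of "\<lambda>_. 1"] by (simp add: marginal_density_def)
  then show "?e = 1"
    using assms(2,3) by (subst (asm) ennreal_mult_cancel_left) auto
qed

section \<open>Bounds for a fixed prior\<close>

text \<open>
  The Bayes estimator of the loss is the posterior expected loss of the first-stage Bayes estimator,
  so averaging it over the marginal distribution gives the integrated Bayes risk.
\<close>

lemma integrated_risk_bayes:
  assumes loss: "first_stage_loss T A L"
    and bayes: "bayes_estimator T N A f L \<pi> (g, l)"
    and const: "\<And>x. x \<in> space N \<Longrightarrow> l x = c"
  shows "integrated_risk T N f L \<pi> g = ennreal c"
proof -
  have [measurable]: "g \<in> measurable N A" "(\<lambda>(\<theta>, d). L \<theta> d) \<in> borel_measurable (T \<Otimes>\<^sub>M A)"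
    using bayes loss by (auto simp: bayes_estimator_def estimators_def first_stage_loss_def)
  have Lm: "(\<lambda>(\<theta>, x). ennreal (L \<theta> (g x))) \<in> borel_measurable (T \<Otimes>\<^sub>M N)"
    by measurable
  have "integrated_risk T N f L \<pi> g = (\<integral>\<^sup>+x. \<integral>\<^sup>+\<theta>. ennreal (L \<theta> (g x)) * (f \<theta> x * \<pi> \<theta>) \<partial>T \<partial>N)"
    unfolding integrated_risk_def risk_def
    using joint_integral_fst[OF Lm] joint_integral_snd[OF Lm] by simp
  also have "\<dots> = (\<integral>\<^sup>+x. marginal x * ennreal c \<partial>N)"
  proof (rule nn_integral_cong_AE)
    have "AE x in N. 0 < marginal x \<longrightarrow> ennreal (l x) = posterior_loss T f L \<pi> x (g x)"
      using bayes by (auto simp: bayes_estimator_def AE_density)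
    with marginal_finite AE_space
    show "AE x in N. (\<integral>\<^sup>+\<theta>. ennreal (L \<theta> (g x)) * (f \<theta> x * \<pi> \<theta>) \<partial>T) = marginal x * ennreal c"
    proof eventually_elim
      case (elim x)
      have [measurable]: "(\<lambda>\<theta>. ennreal (L \<theta> (g x))) \<in> borel_measurable T"
        using measurable_compose[OF measurable_Pair2'[OF elim(2)] Lm] by simp
      show ?case
        using elim const[OF elim(2)] posterior_integral[of x "\<lambda>\<theta>. ennreal (L \<theta> (g x))"]
        by (cases "marginal x = 0") (auto simp: posterior_loss_def zero_less_iff_neq_zero)
    qed
  qed
  also have "\<dots> = ennreal c"
    by (simp add: nn_integral_multc marginal_integral)
  finally show ?thesis .
qed

lemma integrated_risk_constant:
  assumes "\<And>\<theta>. \<theta> \<in> space T \<Longrightarrow> risk N f L \<theta> g = R"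
  shows "integrated_risk T N f L \<pi> g = R"
proof -
  have "integrated_risk T N f L \<pi> g = (\<integral>\<^sup>+\<theta>. R * \<pi> \<theta> \<partial>T)"
    unfolding integrated_risk_def by (intro nn_integral_cong) (simp add: assms)
  then show ?thesis by (simp add: nn_integral_cmult prior_integral)
qed

lemma W_loss_measurable:
  assumes loss: "first_stage_loss T A L" and e: "(g, l) \<in> estimators N A"
    and h: "mono_on {0<..} h" "concave_on {0<..} h" "h differentiable_on {0<..}"
  shows "(\<lambda>(\<theta>, x). W_loss h L \<theta> (g x) (l x)) \<in> borel_measurable (T \<Otimes>\<^sub>M N)"
proof -
  have [measurable]: "g \<in> measurable N A" "(\<lambda>(\<theta>, d). L \<theta> d) \<in> borel_measurable (T \<Otimes>\<^sub>M A)"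
      "l \<in> borel_measurable N"
    using e loss by (auto simp: estimators_def first_stage_loss_def)
  have [measurable]: "(\<lambda>x. h (l x)) \<in> borel_measurable N" "(\<lambda>x. deriv h (l x)) \<in> borel_measurable N"
    using measurable_concave_compose[OF h, of l N] e by (auto simp: estimators_def)
  have [measurable]: "(\<lambda>(\<theta>, x). L \<theta> (g x)) \<in> borel_measurable (T \<Otimes>\<^sub>M N)"
    by measurable
  show ?thesis unfolding W_loss_def by measurable
qed

text \<open>
  Given the observation, every action has posterior expected loss at least \<open>c\<close>, and W is an affine
  function of the loss whose value at \<open>c\<close> is the height at \<open>c\<close> of the tangent to \<open>h\<close> at \<open>l x\<close>;
  by concavity that is at least \<open>h c\<close>.  Averaging over the marginal distribution of the observation
  keeps the bound.
\<close>

lemma joint_W_lower_bound: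
  assumes loss: "first_stage_loss T A L" and e: "(g, l) \<in> estimators N A"
    and h: "mono_on {0<..} h" "concave_on {0<..} h" "h differentiable_on {0<..}"
    and bayes: "bayes_estimator T N A f L \<pi> (g', l')"
    and const: "\<And>x. x \<in> space N \<Longrightarrow> l' x = c" and c: "0 < c"
  shows "(\<integral>\<^sup>+(\<theta>, x). ennreal (- W_loss h L \<theta> (g x) (l x)) \<partial>joint) + ennreal (h c) \<le>
    (\<integral>\<^sup>+(\<theta>, x). ennreal (W_loss h L \<theta> (g x) (l x)) \<partial>joint) + ennreal (- h c)"
proof -
  let ?W = "\<lambda>\<theta> x. W_loss h L \<theta> (g x) (l x)"
  note Wm[measurable] = W_loss_measurable[OF loss e h]
  have Wp[measurable]: "(\<lambda>(\<theta>, x). ennreal (?W \<theta> x)) \<in> borel_measurable (T \<Otimes>\<^sub>M N)"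
    and Wn[measurable]: "(\<lambda>(\<theta>, x). ennreal (- ?W \<theta> x)) \<in> borel_measurable (T \<Otimes>\<^sub>M N)"
    by measurable
  have gm: "g \<in> measurable N A" and Lm: "(\<lambda>(\<theta>, d). L \<theta> d) \<in> borel_measurable (T \<Otimes>\<^sub>M A)"
    using e loss by (auto simp: estimators_def first_stage_loss_def)
  define P where "P x = (\<integral>\<^sup>+\<theta>. ennreal (?W \<theta> x) * (f \<theta> x * \<pi> \<theta>) \<partial>T)" for x
  define Q where "Q x = (\<integral>\<^sup>+\<theta>. ennreal (- ?W \<theta> x) * (f \<theta> x * \<pi> \<theta>) \<partial>T)" for x
  have [measurable]: "P \<in> borel_measurable N" "Q \<in> borel_measurable N"
    unfolding P_def Q_def by measurable
  have "(\<integral>\<^sup>+x. Q x + marginal x * ennreal (h c) \<partial>N) \<le> (\<integral>\<^sup>+x. P x + marginal x * ennreal (- h c) \<partial>N)"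
  proof (rule nn_integral_mono_AE)
    have "AE x in N. 0 < marginal x \<longrightarrow>
        (\<forall>d\<in>space A. posterior_loss T f L \<pi> x (g' x) \<le> posterior_loss T f L \<pi> x d) \<and>
        ennreal (l' x) = posterior_loss T f L \<pi> x (g' x)"
      using bayes by (auto simp: bayes_estimator_def AE_density)
    with marginal_finite AE_space
    show "AE x in N. Q x + marginal x * ennreal (h c) \<le> P x + marginal x * ennreal (- h c)"
    proof eventually_elim
      case (elim x)
      note x = \<open>x \<in> space N\<close>
      have gx: "g x \<in> space A" using measurable_space[OF gm x] .
      have lx: "0 < l x" using e x by (auto simp: estimators_def)
      define a where "a = deriv h (l x)"
      define K where "K = h (l x) - a * l x"
      let ?M = "posterior T f \<pi> x"
      have Weq: "?W \<theta> x = a * L \<theta> (g x) + K" for \<theta>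
        by (simp add: W_loss_def a_def K_def)
      have Lx[measurable]: "(\<lambda>\<theta>. L \<theta> (g x)) \<in> borel_measurable T"
        using measurable_compose[OF measurable_Pair2'[OF gx] Lm] by simp
      have PQ: "P x = marginal x * (\<integral>\<^sup>+\<theta>. ennreal (a * L \<theta> (g x) + K) \<partial>?M)"
          "Q x = marginal x * (\<integral>\<^sup>+\<theta>. ennreal (- (a * L \<theta> (g x) + K)) \<partial>?M)"
        unfolding P_def Q_def Weq using elim by (auto intro!: posterior_integral)
      show ?case
      proof (cases "marginal x = 0")
        case False
        have "(\<integral>\<^sup>+\<theta>. ennreal (- (a * L \<theta> (g x) + K)) \<partial>?M) + ennreal (h c) \<le>
            (\<integral>\<^sup>+\<theta>. ennreal (a * L \<theta> (g x) + K) \<partial>?M) + ennreal (- h c)"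
        proof (rule nn_integral_affine_ge)
          show "prob_space ?M" using prob_space_posterior elim False by blast
          show "(\<lambda>\<theta>. L \<theta> (g x)) \<in> borel_measurable ?M"
            using Lx by (simp add: posterior_def)
          show "0 \<le> L \<theta> (g x)" if "\<theta> \<in> space ?M" for \<theta>
            using loss gx that by (simp add: posterior_def first_stage_loss_def)
          show "0 \<le> a" unfolding a_def using concave_deriv_nonneg[OF h lx] .
          show "ennreal c \<le> (\<integral>\<^sup>+\<theta>. ennreal (L \<theta> (g x)) \<partial>?M)"
            using elim False gx const[OF x] by (auto simp: posterior_loss_def zero_less_iff_neq_zero)
          show "h c \<le> a * c + K"
            using concave_below_tangent[OF h(2,3) c lx] by (simp add: a_def K_def algebra_simps)
        qed (use c in simp)
        then show ?thesis
          unfolding PQ distrib_left[symmetric] by (rule mult_left_mono) simp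
      qed (simp add: PQ)
    qed
  qed
  then have "(\<integral>\<^sup>+x. Q x \<partial>N) + ennreal (h c) \<le> (\<integral>\<^sup>+x. P x \<partial>N) + ennreal (- h c)"
    by (simp add: nn_integral_add nn_integral_multc marginal_integral)
  then show ?thesis
    unfolding joint_integral_snd[OF Wp] joint_integral_snd[OF Wn] P_def Q_def .
qed

text \<open>
  The hypothesis bounds the expectation over the observation for each parameter; averaging these
  bounds over the prior gives the bound for the joint expectation.
\<close>

lemma joint_W_upper_bound:
  assumes loss: "first_stage_loss T A L" and e: "(g, l) \<in> estimators N A"
    and h: "mono_on {0<..} h" "concave_on {0<..} h" "h differentiable_on {0<..}"
    and bound: "\<And>\<theta>. \<theta> \<in> space T \<Longrightarrow> W_risk N f h L \<theta> (g, l) \<le> ereal b"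
  shows "(\<integral>\<^sup>+(\<theta>, x). ennreal (W_loss h L \<theta> (g x) (l x)) \<partial>joint) + ennreal (- b) \<le>
    (\<integral>\<^sup>+(\<theta>, x). ennreal (- W_loss h L \<theta> (g x) (l x)) \<partial>joint) + ennreal b"
proof -
  let ?W = "\<lambda>\<theta> x. W_loss h L \<theta> (g x) (l x)"
  note Wm[measurable] = W_loss_measurable[OF loss e h]
  have Wp[measurable]: "(\<lambda>(\<theta>, x). ennreal (?W \<theta> x)) \<in> borel_measurable (T \<Otimes>\<^sub>M N)"
    and Wn[measurable]: "(\<lambda>(\<theta>, x). ennreal (- ?W \<theta> x)) \<in> borel_measurable (T \<Otimes>\<^sub>M N)"
    by measurable
  define P where "P \<theta> = (\<integral>\<^sup>+x. ennreal (?W \<theta> x) \<partial>density N (f \<theta>))" for \<theta>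
  define Q where "Q \<theta> = (\<integral>\<^sup>+x. ennreal (- ?W \<theta> x) \<partial>density N (f \<theta>))" for \<theta>
  have meas: "(\<lambda>\<theta>. \<integral>\<^sup>+x. w \<theta> x \<partial>density N (f \<theta>)) \<in> borel_measurable T"
    if [measurable]: "(\<lambda>(\<theta>, x). w \<theta> x) \<in> borel_measurable (T \<Otimes>\<^sub>M N)" for w :: "'p \<Rightarrow> 'x \<Rightarrow> ennreal"
  proof (subst measurable_cong)
    fix \<theta> assume \<theta>: "\<theta> \<in> space T"
    have [measurable]: "f \<theta> \<in> borel_measurable N" "w \<theta> \<in> borel_measurable N"
      using density_measurable[OF \<theta>] measurable_compose[OF measurable_Pair1'[OF \<theta>] that] by simp_all
    show "(\<integral>\<^sup>+x. w \<theta> x \<partial>density N (f \<theta>)) = (\<integral>\<^sup>+x. f \<theta> x * w \<theta> x \<partial>N)"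
      by (simp add: nn_integral_density)
  qed measurable
  have [measurable]: "P \<in> borel_measurable T" "Q \<in> borel_measurable T"
    unfolding P_def Q_def by (intro meas; simp)+
  have "(\<integral>\<^sup>+\<theta>. P \<theta> * \<pi> \<theta> + ennreal (- b) * \<pi> \<theta> \<partial>T) \<le> (\<integral>\<^sup>+\<theta>. Q \<theta> * \<pi> \<theta> + ennreal b * \<pi> \<theta> \<partial>T)"
  proof (rule nn_integral_mono)
    fix \<theta> assume "\<theta> \<in> space T"
    from bound[OF this] have "P \<theta> + ennreal (- b) \<le> Q \<theta> + ennreal b"
      by (simp add: W_risk_def expectation_ereal_le_iff P_def Q_def)
    then show "P \<theta> * \<pi> \<theta> + ennreal (- b) * \<pi> \<theta> \<le> Q \<theta> * \<pi> \<theta> + ennreal b * \<pi> \<theta>"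
      unfolding distrib_right[symmetric] by (rule mult_right_mono) simp
  qed
  then have "(\<integral>\<^sup>+\<theta>. P \<theta> * \<pi> \<theta> \<partial>T) + ennreal (- b) \<le> (\<integral>\<^sup>+\<theta>. Q \<theta> * \<pi> \<theta> \<partial>T) + ennreal b"
    by (simp add: nn_integral_add nn_integral_cmult prior_integral)
  then show ?thesis
    unfolding joint_integral_fst[OF Wp] joint_integral_fst[OF Wn] P_def Q_def .
qed

text \<open>
  The two bounds evaluate the same joint expectation in the two orders.  They are comparable
  because the joint expectation exists: its two parts cannot both be infinite.
\<close>

lemma bayes_W_bound_le_risk_bound:
  assumes loss: "first_stage_loss T A L" and e: "(g, l) \<in> estimators N A"
    and h: "mono_on {0<..} h" "concave_on {0<..} h" "h differentiable_on {0<..}"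
    and bayes: "bayes_estimator T N A f L \<pi> (g', l')"
    and const: "\<And>x. x \<in> space N \<Longrightarrow> l' x = c" and c: "0 < c"
    and exists: "integrated_W_risk_exists T N f h L \<pi> (g, l)"
    and bound: "\<And>\<theta>. \<theta> \<in> space T \<Longrightarrow> W_risk N f h L \<theta> (g, l) \<le> ereal b"
  shows "h c \<le> b"
proof -
  define P where "P = (\<integral>\<^sup>+(\<theta>, x). ennreal (W_loss h L \<theta> (g x) (l x)) \<partial>joint)"
  define Q where "Q = (\<integral>\<^sup>+(\<theta>, x). ennreal (- W_loss h L \<theta> (g x) (l x)) \<partial>joint)"
  have lower: "Q + ennreal (h c) \<le> P + ennreal (- h c)"
    unfolding P_def Q_def by (rule joint_W_lower_bound[OF loss e h bayes const c])
  have upper: "P + ennreal (- b) \<le> Q + ennreal b"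
    unfolding P_def Q_def by (rule joint_W_upper_bound[OF loss e h bound])
  have "P < \<infinity> \<or> Q < \<infinity>"
    using exists
    by (simp add: integrated_W_risk_exists_def quasi_integrable_def P_def Q_def case_prod_beta')
  then have fin: "P < \<infinity>" "Q < \<infinity>"
    using lower upper by (cases P; cases Q; auto simp: top_unique)+
  then obtain p q where pq: "P = ennreal p" "Q = ennreal q" "0 \<le> p" "0 \<le> q"
    by (cases P; cases Q) auto
  have "ennreal (q + max 0 (h c)) \<le> ennreal (p + max 0 (- h c))"
    using lower pq by (simp add: ennreal_plus ennreal_max_0)
  moreover have "ennreal (p + max 0 (- b)) \<le> ennreal (q + max 0 b)"
    using upper pq by (simp add: ennreal_plus ennreal_max_0)
  ultimately have "q + max 0 (h c) \<le> p + max 0 (- h c)" "p + max 0 (- b) \<le> q + max 0 b"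
    using pq by (auto simp: ennreal_le_iff simp del: ennreal_plus)
  then show ?thesis by linarith
qed

text \<open>
  With a constant loss estimate, W is one and the same affine function of the nonnegative first-stage
  loss for all observations, with nonnegative slope, so it is bounded below even if \<open>h\<close> is not.
\<close>

lemma constant_loss_estimate_quasi_integrable:
  assumes loss: "first_stage_loss T A L" and e: "(g, l) \<in> estimators N A"
    and h: "mono_on {0<..} h" "concave_on {0<..} h" "h differentiable_on {0<..}"
    and const: "\<And>x. x \<in> space N \<Longrightarrow> l x = c" and c: "0 < c"
  shows "W_risk_exists T N f h L (g, l)" "integrated_W_risk_exists T N f h L \<pi> (g, l)"
proof -
  have W: "h c - deriv h c * c \<le> W_loss h L \<theta> (g x) (l x)" if "\<theta> \<in> space T" "x \<in> space N" for \<theta> x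
  proof -
    have "0 \<le> L \<theta> (g x)"
      using loss e that by (auto simp: estimators_def first_stage_loss_def dest: measurable_space)
    then show ?thesis
      using concave_deriv_nonneg[OF h c] const[OF that(2)] by (simp add: W_loss_def)
  qed
  show "W_risk_exists T N f h L (g, l)"
    unfolding W_risk_exists_def case_prod_conv
  proof
    fix \<theta> assume \<theta>: "\<theta> \<in> space T"
    show "quasi_integrable (density N (f \<theta>)) (\<lambda>x. W_loss h L \<theta> (g x) (l x))"
      by (rule quasi_integrable_bounded_below[where B = "h c - deriv h c * c"])
         (use prob_space.emeasure_space_1[OF prob_space_density[OF \<theta>]] W \<theta> in auto)
  qed
  show "integrated_W_risk_exists T N f h L \<pi> (g, l)"
    unfolding integrated_W_risk_exists_def case_prod_conv
    by (rule quasi_integrable_bounded_below[where B = "h c - deriv h c * c"])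
       (use joint_mass W in \<open>auto simp: space_pair_measure\<close>)
qed

text \<open>An unbiased loss estimate cancels the terms of W that involve \<open>deriv h c\<close>.\<close>

lemma W_risk_constant_loss_estimate:
  assumes loss: "first_stage_loss T A L" and e: "(g, l) \<in> estimators N A"
    and h: "mono_on {0<..} h" "concave_on {0<..} h" "h differentiable_on {0<..}"
    and const: "\<And>x. x \<in> space N \<Longrightarrow> l x = c" and c: "0 < c"
    and \<theta>: "\<theta> \<in> space T" and risk: "risk N f L \<theta> g = ennreal c"
  shows "W_risk N f h L \<theta> (g, l) \<le> ereal (h c)"
proof -
  let ?a = "deriv h c" and ?M = "density N (f \<theta>)"
  have gm: "g \<in> measurable N A" and Lm: "(\<lambda>(\<theta>, d). L \<theta> d) \<in> borel_measurable (T \<Otimes>\<^sub>M A)"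
    using e loss by (auto simp: estimators_def first_stage_loss_def)
  have "expectation_ereal ?M (\<lambda>x. ?a * L \<theta> (g x) + (h c - ?a * c)) \<le> ereal (?a * c + (h c - ?a * c))"
  proof (rule expectation_ereal_affine_le)
    show "prob_space ?M" using prob_space_density[OF \<theta>] .
    show "(\<lambda>x. L \<theta> (g x)) \<in> borel_measurable ?M"
      using measurable_compose[OF gm measurable_compose[OF measurable_Pair1'[OF \<theta>] Lm]] by simp
    show "0 \<le> L \<theta> (g x)" if "x \<in> space ?M" for x
      using loss \<theta> that measurable_space[OF gm] by (simp add: first_stage_loss_def)
    show "0 \<le> ?a" using concave_deriv_nonneg[OF h c] .
    show "(\<integral>\<^sup>+x. ennreal (L \<theta> (g x)) \<partial>?M) = ennreal c" using risk by (simp add: risk_def)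
  qed (use c in simp)
  moreover have "W_risk N f h L \<theta> (g, l) =
      expectation_ereal ?M (\<lambda>x. ?a * L \<theta> (g x) + (h c - ?a * c))"
    unfolding W_risk_def expectation_ereal_def case_prod_conv
    by (intro arg_cong2[where f = "(-)"] arg_cong[where f = enn2ereal] nn_integral_cong)
       (simp_all add: W_loss_def const algebra_simps)
  ultimately show ?thesis by simp
qed

end

section \<open>Minimaxity of the limit of Bayes estimators\<close>

theorem theorem7:
  fixes T :: "'p measure" and N :: "'x measure" and A :: "'a measure"
    and f :: "'p \<Rightarrow> 'x \<Rightarrow> ennreal" and L :: "'p \<Rightarrow> 'a \<Rightarrow> real" and h :: "real \<Rightarrow> real"
    and \<pi> :: "nat \<Rightarrow> 'p \<Rightarrow> ennreal"
    and \<gamma>\<^sub>0 :: "'x \<Rightarrow> 'a" and L\<^sub>0 :: "'x \<Rightarrow> real"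
    and \<gamma>\<^sub>B :: "nat \<Rightarrow> 'x \<Rightarrow> 'a" and L\<^sub>B :: "nat \<Rightarrow> 'x \<Rightarrow> real"
  assumes model: "dominated_model T N f"
    and loss: "first_stage_loss T A L"
    and h_increasing: "mono_on {0<..} h"
    and h_concave: "concave_on {0<..} h"
    and h_differentiable: "h differentiable_on {0<..}"
    and estimator: "(\<gamma>\<^sub>0, L\<^sub>0) \<in> estimators N A"
    and priors: "\<And>n. 1 \<le> n \<Longrightarrow> proper_prior T (\<pi> n)"
    and bayes: "\<And>n. 1 \<le> n \<Longrightarrow> bayes_estimator T N A f L (\<pi> n) (\<gamma>\<^sub>B n, L\<^sub>B n)"
    and i_extended_bayes: "extended_bayes T N f L \<pi> \<gamma>\<^sub>B \<gamma>\<^sub>0"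
    and i_constant_risk: "constant_finite_risk T N f L \<gamma>\<^sub>0"
    and ii: "\<And>n. 1 \<le> n \<Longrightarrow> \<exists>c. \<forall>x\<in>space N. L\<^sub>B n x = c"
    and iii: "\<And>x. x \<in> space N \<Longrightarrow> (\<lambda>n. L\<^sub>B n x) \<longlonglongrightarrow> L\<^sub>0 x"
  shows "minimax_among T N f h L (admitted_estimators T N A f h L \<pi>) (\<gamma>\<^sub>0, L\<^sub>0)"
proof -
  interpret dominated_model T N f by fact
  have bm: "bayesian_model T N f (\<pi> n)" if "1 \<le> n" for n
    using model priors[OF that] by (simp add: bayesian_model_def bayesian_model_axioms_def)
  interpret B1: bayesian_model T N f "\<pi> 1" by (rule bm) simp
  note h = h_increasing h_concave h_differentiable
  have "space T \<noteq> {}"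
    using B1.prior_integral by (auto simp: nn_integral_empty)
  then obtain \<theta>\<^sub>0 where \<theta>\<^sub>0: "\<theta>\<^sub>0 \<in> space T" by blast
  have "space N \<noteq> {}"
    using f_integral[OF \<theta>\<^sub>0] by (auto simp: nn_integral_empty)
  then obtain x\<^sub>0 where x\<^sub>0: "x\<^sub>0 \<in> space N" by blast
  define c where "c n = L\<^sub>B n x\<^sub>0" for n
  have cn: "L\<^sub>B n x = c n" if "1 \<le> n" "x \<in> space N" for n x
    using ii[OF that(1)] that(2) x\<^sub>0 by (auto simp: c_def)
  have cpos: "0 < c n" if "1 \<le> n" for n
    using bayes[OF that] x\<^sub>0 by (auto simp: c_def bayes_estimator_def estimators_def)
  define C where "C = L\<^sub>0 x\<^sub>0"
  have clim: "c \<longlonglongrightarrow> C"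
    using iii[OF x\<^sub>0] by (simp add: c_def[abs_def] C_def)
  have Cpos: "0 < C"
    using estimator x\<^sub>0 by (auto simp: C_def estimators_def)
  have C: "L\<^sub>0 x = C" if x: "x \<in> space N" for x
  proof (rule LIMSEQ_unique[OF iii[OF x]])
    show "(\<lambda>n. L\<^sub>B n x) \<longlonglongrightarrow> C"
      by (rule Lim_transform_eventually[OF clim])
         (use cn x in \<open>auto simp: eventually_sequentially intro!: exI[of _ 1]\<close>)
  qed

  \<comment> \<open>The integrated Bayes risk under \<open>\<pi> n\<close> is \<open>c n\<close>, so the constant risk of \<open>\<gamma>\<^sub>0\<close> is \<open>C\<close>.\<close>
  obtain R where R: "R < \<infinity>" "\<And>\<theta>. \<theta> \<in> space T \<Longrightarrow> risk N f L \<theta> \<gamma>\<^sub>0 = R"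
    using i_constant_risk by (auto simp: constant_finite_risk_def)
  then obtain r where r: "R = ennreal r" "0 \<le> r" by (cases R) auto
  have "(\<lambda>n. ereal (r - c n)) \<longlonglongrightarrow> ereal 0"
  proof (rule Lim_transform_eventually)
    show "(\<lambda>n. enn2ereal (integrated_risk T N f L (\<pi> n) \<gamma>\<^sub>0) -
        enn2ereal (integrated_risk T N f L (\<pi> n) (\<gamma>\<^sub>B n))) \<longlonglongrightarrow> ereal 0"
      using i_extended_bayes by (simp add: extended_bayes_def zero_ereal_def)
    have "enn2ereal (integrated_risk T N f L (\<pi> n) \<gamma>\<^sub>0) -
        enn2ereal (integrated_risk T N f L (\<pi> n) (\<gamma>\<^sub>B n)) = ereal (r - c n)" if n: "1 \<le> n" for n
      using bayesian_model.integrated_risk_constant[OF bm[OF n] R(2)]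
        bayesian_model.integrated_risk_bayes[OF bm[OF n] loss bayes[OF n] cn[OF n]]
        r cpos[OF n] by (simp add: enn2ereal_ennreal less_imp_le)
    then show "\<forall>\<^sub>F n in sequentially. enn2ereal (integrated_risk T N f L (\<pi> n) \<gamma>\<^sub>0) -
        enn2ereal (integrated_risk T N f L (\<pi> n) (\<gamma>\<^sub>B n)) = ereal (r - c n)"
      by (auto simp: eventually_sequentially)
  qed
  then have "(\<lambda>n. r - c n) \<longlonglongrightarrow> 0" by simp
  moreover have "(\<lambda>n. r - c n) \<longlonglongrightarrow> r - C"
    by (intro tendsto_intros clim)
  ultimately have "r = C"
    using LIMSEQ_unique by force
  with R r have risk: "risk N f L \<theta> \<gamma>\<^sub>0 = ennreal C" if "\<theta> \<in> space T" for \<theta>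
    using that by simp

  have admitted: "(\<gamma>\<^sub>0, L\<^sub>0) \<in> admitted_estimators T N A f h L \<pi>"
    using bayesian_model.constant_loss_estimate_quasi_integrable[OF bm loss estimator h C Cpos] estimator
    by (auto simp: admitted_estimators_def)
  have upper: "(SUP \<theta>\<in>space T. W_risk N f h L \<theta> (\<gamma>\<^sub>0, L\<^sub>0)) \<le> ereal (h C)"
    using B1.W_risk_constant_loss_estimate[OF loss estimator h C Cpos] risk by (auto intro!: SUP_least)
  have lower: "ereal (h C) \<le> (SUP \<theta>\<in>space T. W_risk N f h L \<theta> e)" (is "_ \<le> ?S")
    if "e \<in> admitted_estimators T N A f h L \<pi>" for e
  proof (rule ereal_le_real)
    fix b assume b: "?S \<le> ereal b"
    obtain g l where e: "e = (g, l)" by force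
    have "h (c n) \<le> b" if n: "1 \<le> n" for n
    proof (rule bayesian_model.bayes_W_bound_le_risk_bound[OF bm[OF n] loss _ h bayes[OF n] cn[OF n] cpos[OF n]])
      show "(g, l) \<in> estimators N A" "integrated_W_risk_exists T N f h L (\<pi> n) (g, l)"
        using \<open>e \<in> _\<close> n by (auto simp: admitted_estimators_def e)
      show "W_risk N f h L \<theta> (g, l) \<le> ereal b" if "\<theta> \<in> space T" for \<theta>
        using b that unfolding e by (meson SUP_upper order_trans)
    qed
    moreover have "(\<lambda>n. h (c n)) \<longlonglongrightarrow> h C"
      using isCont_tendsto_compose[OF DERIV_isCont[OF differentiable_on_pos_DERIV[OF h(3) Cpos]] clim] .
    ultimately have "h C \<le> b"
      by (intro LIMSEQ_le_const2) auto
    then show "ereal (h C) \<le> ereal b" by simp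
  qed
  show ?thesis
    unfolding minimax_among_def using admitted upper lower order_trans by blast
qed

end
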